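(* Let $\tau$ be a Fibonacci pattern with $r\ge 1$ inversions. For every $k\ge r$, there is a polynomial $P$ of degree $r-1$ and an integer $n_0=n_0(k,\tau)$ such that $S_n^k(\tau)=P(n)$ for all $n\ge n_0$.
   Context: A permutation $\pi=\pi_1\cdots\pi_n$ of $\{1,\dots,n\}$ contains a permutation (pattern) $\tau$ of length $\ell$ if there are indices $i_1<\cdots<i_\ell$ such that $\pi_{i_1}\cdots\pi_{i_\ell}$ is order-isomorphic to $\tau$; otherwise $\pi$ avoids $\tau$. An inversion in $\pi$ is a pair $(i,j)$ with $1\le i<j\le n$ and $\pi_i>\pi_j$. $S_n^k(\tau)$ denotes the number of permutations of length $n$ avoiding $\tau$ that have exactly $k$ inversions. The direct sum $\sigma\oplus\rho$ of permutations $\sigma$ of length $a$ and $\rho$ of length $b$ is the permutation of length $a+b$ with $(\sigma\oplus\rho)(i)=\sigma(i)$ for $i\le a$ and $(\sigma\oplus\rho)(i)=\rho(i-a)+a$ for $i>a$. A Fibonacci permutation (or pattern) is a permutation that can be written as a direct sum $\alpha_1\oplus\alpha_2\oplus\cdots\oplus\alpha_m$ where each $\alpha_i$ is equal to $1$ or to $21$.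
   Formalization: For the single pattern 21 (r = 1), no permutation with k ≥ 1 inversions avoids it, so the polynomial is zero; the formal statement allows the zero polynomial, counted as having degree 0, in this case only, and requires a nonzero polynomial of degree exactly r − 1 otherwise. *)

theory Defs
  imports
    "HOL-Computational_Algebra.Polynomial"
    "HOL-Combinatorics.Multiset_Permutations"
begin

text \<open>
  A permutation of length \<open>n\<close> is given in one-line notation, as a list in
  \<open>permutations_of_set {1..n}\<close>. List positions start at \<open>0\<close>, values at \<open>1\<close>.
\<close>

definition inversions :: "nat list \<Rightarrow> (nat \<times> nat) set" where
  "inversions \<pi> = {(i, j). i < j \<and> j < length \<pi> \<and> \<pi> ! i > \<pi> ! j}"

text \<open>The map \<open>f\<close> is the sequence of positions of an occurrence of \<open>\<tau>\<close> in \<open>\<pi>\<close>.\<close>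

definition contains_pattern :: "nat list \<Rightarrow> nat list \<Rightarrow> bool" where
  "contains_pattern \<pi> \<tau> \<longleftrightarrow>
     (\<exists>f :: nat \<Rightarrow> nat.
        strict_mono_on {..<length \<tau>} f \<and>
        f ` {..<length \<tau>} \<subseteq> {..<length \<pi>} \<and>
        (\<forall>a < length \<tau>. \<forall>b < length \<tau>. \<pi> ! f a < \<pi> ! f b \<longleftrightarrow> \<tau> ! a < \<tau> ! b))"

abbreviation avoids_pattern :: "nat list \<Rightarrow> nat list \<Rightarrow> bool" where
  "avoids_pattern \<pi> \<tau> \<equiv> \<not> contains_pattern \<pi> \<tau>"

definition avoiders_count :: "nat \<Rightarrow> nat \<Rightarrow> nat list \<Rightarrow> nat" where
  "avoiders_count n k \<tau> =
     card {\<pi> \<in> permutations_of_set {1..n}. avoids_pattern \<pi> \<tau> \<and> card (inversions \<pi>) = k}"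

definition direct_sum :: "nat list \<Rightarrow> nat list \<Rightarrow> nat list" where
  "direct_sum \<sigma> \<rho> = \<sigma> @ map (\<lambda>x. x + length \<sigma>) \<rho>"

text \<open>The empty list is a neutral element for \<open>direct_sum\<close>, so it can end the fold.\<close>

definition fibonacci_permutation :: "nat list \<Rightarrow> bool" where
  "fibonacci_permutation \<tau> \<longleftrightarrow>
     (\<exists>\<alpha>s. \<alpha>s \<noteq> [] \<and> set \<alpha>s \<subseteq> {[1], [2, 1]} \<and> \<tau> = foldr direct_sum \<alpha>s [])"

end

theory Submission
  imports Defs
begin

text \<open>
  Every nonempty permutation is uniquely \<open>\<beta> \<oplus> \<rho>\<close> with \<open>\<beta>\<close> indecomposable, and inversions
  add up over direct sums. For a Fibonacci pattern \<open>\<tau>\<close> with blocks \<open>\<alpha>\<^sub>1, \<dots>, \<alpha>\<^sub>m\<close>, matching is greedy: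
  \<open>\<beta> \<oplus> \<rho>\<close> contains \<open>\<tau>\<close> iff \<open>\<rho>\<close> contains what is left of \<open>\<tau>\<close> after deleting the longest prefix
  of blocks contained in \<open>\<beta>\<close> (\<open>contains_direct_sum_iff_residual\<close>). Writing \<open>\<tau>/\<beta>\<close> for this
  residual pattern, one gets
  \<open>S\<^sub>n\<^sup>k(\<tau>) = (\<Sum>\<beta>. S\<^sub>m\<^sup>l(\<tau>/\<beta>))\<close> with \<open>m = n - |\<beta>|\<close> and \<open>l = k - inv \<beta>\<close>
  (\<open>avoiders_count_rec\<close>). The sum is finite independently of \<open>n\<close>, as an indecomposable
  permutation with at most \<open>k\<close> inversions has length at most \<open>k\<^sup>2 + 1\<close>.

  Polynomiality follows by induction on the number of blocks of \<open>\<tau>\<close>, with the statement that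
  \<open>S\<^sub>n\<^sup>k(\<tau>)\<close> is eventually a polynomial all of whose terms have degree less than the number
  \<open>r\<close> of blocks 21. Each \<open>\<beta> \<noteq> 1\<close> contains 21, hence consumes at least the first block. If \<open>\<tau>\<close> starts
  with 1, then \<open>\<beta> = 1\<close> consumes that block, and all terms of the recursion have fewer blocks. If \<open>\<tau>\<close> starts
  with 21, the summand for \<open>\<beta> = 1\<close> is \<open>S\<^sub>m\<^sup>k(\<tau>)\<close> with \<open>m = n - 1\<close>, and the others have lost a
  block 21; so \<open>S\<^sub>n\<^sup>k(\<tau>)\<close> consists of the partial sums of a function covered by the induction
  hypothesis with \<open>r - 1\<close> in place of \<open>r\<close>, and summation raises the degree by at most one
  (\<open>avoiders_count_eventually_poly\<close>).

  That the degree is not smaller follows from the same recursion read as an inequality, keeping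
  only one or two summands. For a leading 21 these are \<open>\<beta> = 1\<close> and a permutation
  \<open>(j+1) 1 2 \<dots> j\<close>, which consumes exactly that block. By Pascal's rule this yields a lower bound by a binomial
  coefficient \<open>x choose (r - 1)\<close> with \<open>x = n - m\<close>, where \<open>m\<close> is a constant
  (\<open>avoiders_count_growth\<close>). The pattern 21 itself is different: no permutation with a positive
  number of inversions avoids it, so its polynomial is zero.
\<close>

section \<open>Direct sums of permutations\<close>

definition is_permutation :: "nat list \<Rightarrow> bool" where
  "is_permutation \<pi> \<longleftrightarrow> distinct \<pi> \<and> set \<pi> = {1..length \<pi>}"

lemma mem_permutations_iff:
  "\<pi> \<in> permutations_of_set {1..n} \<longleftrightarrow> is_permutation \<pi> \<and> length \<pi> = n"
proof
  assume "\<pi> \<in> permutations_of_set {1..n}"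
  then have *: "set \<pi> = {1..n}" "distinct \<pi>" by (rule permutations_of_setD)+
  moreover from distinct_card[OF *(2)] have "length \<pi> = n" by (simp add: *(1))
  ultimately show "is_permutation \<pi> \<and> length \<pi> = n" by (simp add: is_permutation_def)
next
  assume "is_permutation \<pi> \<and> length \<pi> = n"
  then show "\<pi> \<in> permutations_of_set {1..n}"
    by (intro permutations_of_setI) (auto simp: is_permutation_def)
qed

lemma permutation_nth:
  assumes "is_permutation \<pi>" "i < length \<pi>"
  shows "1 \<le> \<pi> ! i" "\<pi> ! i \<le> length \<pi>"
  using assms nth_mem[of i \<pi>] by (auto simp: is_permutation_def)

lemma length_direct_sum [simp]: "length (direct_sum \<sigma> \<rho>) = length \<sigma> + length \<rho>"
  by (simp add: direct_sum_def)

lemma direct_sum_nth: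
  "i < length \<sigma> + length \<rho> \<Longrightarrow>
     direct_sum \<sigma> \<rho> ! i = (if i < length \<sigma> then \<sigma> ! i else \<rho> ! (i - length \<sigma>) + length \<sigma>)"
  by (auto simp: direct_sum_def nth_append)

lemma direct_sum_Nil [simp]: "direct_sum [] \<rho> = \<rho>" "direct_sum \<sigma> [] = \<sigma>"
  by (auto simp: direct_sum_def)

lemma direct_sum_assoc: "direct_sum (direct_sum \<pi> \<sigma>) \<rho> = direct_sum \<pi> (direct_sum \<sigma> \<rho>)"
  by (auto simp: direct_sum_def)

lemma permutation_direct_sum:
  assumes "is_permutation \<sigma>" "is_permutation \<rho>"
  shows "is_permutation (direct_sum \<sigma> \<rho>)"
proof -
  have eq: "(\<lambda>x. x + length \<sigma>) ` {1..length \<rho>} = {length \<sigma> + 1..length \<sigma> + length \<rho>}"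
    unfolding image_add_atLeastAtMost' by (simp only: add.commute)
  have "set (direct_sum \<sigma> \<rho>) = {1..length \<sigma>} \<union> {length \<sigma> + 1..length \<sigma> + length \<rho>}"
    using assms by (simp only: is_permutation_def direct_sum_def set_append set_map eq)
  then show ?thesis
    using assms by (auto simp: is_permutation_def direct_sum_def distinct_map inj_on_def)
qed

lemma finite_inversions [simp]: "finite (inversions \<pi>)"
  by (rule finite_subset[of _ "{..<length \<pi>} \<times> {..<length \<pi>}"]) (auto simp: inversions_def)

lemma inversions_direct_sum:
  assumes "is_permutation \<sigma>" "is_permutation \<rho>"
  shows "inversions (direct_sum \<sigma> \<rho>) =
    inversions \<sigma> \<union> (\<lambda>(i, j). (i + length \<sigma>, j + length \<sigma>)) ` inversions \<rho>" (is "?L = ?R")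
proof (intro equalityI subsetI)
  fix x assume "x \<in> ?L"
  then obtain i j where x: "x = (i, j)" and ij: "i < j" "j < length \<sigma> + length \<rho>"
    and gt: "direct_sum \<sigma> \<rho> ! i > direct_sum \<sigma> \<rho> ! j"
    by (auto simp: inversions_def)
  consider "j < length \<sigma>" | "i < length \<sigma>" "length \<sigma> \<le> j" | "length \<sigma> \<le> i" by linarith
  then show "x \<in> ?R"
  proof cases
    case 1
    then show ?thesis using ij gt by (auto simp: x inversions_def direct_sum_nth)
  next
    case 2
    then have "\<sigma> ! i \<le> length \<sigma>" using permutation_nth(2)[OF assms(1)] by simp
    then show ?thesis using 2 ij gt by (auto simp: direct_sum_nth)
  next
    case 3
    then have "(i - length \<sigma>, j - length \<sigma>) \<in> inversions \<rho>"
      using ij gt by (auto simp: inversions_def direct_sum_nth)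
    then show ?thesis using 3 ij by (force simp: x image_iff)
  qed
qed (auto simp: inversions_def direct_sum_nth)

lemma card_inversions_direct_sum:
  assumes "is_permutation \<sigma>" "is_permutation \<rho>"
  shows "card (inversions (direct_sum \<sigma> \<rho>)) = card (inversions \<sigma>) + card (inversions \<rho>)"
proof -
  let ?s = "\<lambda>(i, j). (i + length \<sigma>, j + length \<sigma>)"
  have "card (?s ` inversions \<rho>) = card (inversions \<rho>)"
    by (rule card_image) (auto simp: inj_on_def)
  moreover have "inversions \<sigma> \<inter> ?s ` inversions \<rho> = {}"
    by (auto simp: inversions_def)
  ultimately show ?thesis
    by (simp add: inversions_direct_sum[OF assms] card_Un_disjoint)
qed

section \<open>Fibonacci patterns as lists of blocks\<close>

definition fib_blocks :: "nat list list \<Rightarrow> bool" where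
  "fib_blocks \<alpha>s \<longleftrightarrow> set \<alpha>s \<subseteq> {[1], [2, 1]}"

definition fib :: "nat list list \<Rightarrow> nat list" where
  "fib \<alpha>s = foldr direct_sum \<alpha>s []"

lemma fib_blocks_simps [simp]:
  "fib_blocks []" "fib_blocks (\<alpha> # \<alpha>s) \<longleftrightarrow> (\<alpha> = [1] \<or> \<alpha> = [2, 1]) \<and> fib_blocks \<alpha>s"
  by (auto simp: fib_blocks_def)

lemma fib_blocks_take_drop [simp]:
  "fib_blocks \<alpha>s \<Longrightarrow> fib_blocks (take j \<alpha>s)" "fib_blocks \<alpha>s \<Longrightarrow> fib_blocks (drop j \<alpha>s)"
  unfolding fib_blocks_def by (meson order_trans set_take_subset set_drop_subset)+

lemma fib_simps [simp]: "fib [] = []" "fib (\<alpha> # \<alpha>s) = direct_sum \<alpha> (fib \<alpha>s)"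
  by (auto simp: fib_def)

lemma fib_append: "fib (\<alpha>s @ \<beta>s) = direct_sum (fib \<alpha>s) (fib \<beta>s)"
  by (induction \<alpha>s) (auto simp: direct_sum_assoc)

lemma permutation_block:
  "is_permutation []" "is_permutation [Suc 0]" "is_permutation [2, Suc 0]"
  by (auto simp: is_permutation_def)

lemma permutation_fib: "fib_blocks \<alpha>s \<Longrightarrow> is_permutation (fib \<alpha>s)"
  by (induction \<alpha>s) (auto intro!: permutation_direct_sum simp: permutation_block)

lemma card_inversions_block:
  "inversions [Suc 0] = {}" "card (inversions [2, Suc 0]) = 1"
proof -
  show "inversions [Suc 0] = {}" by (auto simp: inversions_def)
  have "inversions [2, Suc 0] = {(0, 1)}" by (auto simp: inversions_def less_Suc_eq)
  then show "card (inversions [2, Suc 0]) = 1" by simp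
qed

lemma card_inversions_fib:
  "fib_blocks \<alpha>s \<Longrightarrow> card (inversions (fib \<alpha>s)) = count_list \<alpha>s [2, 1]"
proof (induction \<alpha>s)
  case Nil
  then show ?case by (auto simp: inversions_def)
next
  case (Cons \<alpha> \<alpha>s)
  then have "is_permutation \<alpha>" "is_permutation (fib \<alpha>s)"
    by (auto simp: permutation_block permutation_fib)
  then show ?case
    using Cons by (auto simp: card_inversions_direct_sum card_inversions_block)
qed

text \<open>
  A block 21 has no interior cut without an inversion across it, so the cuts of a Fibonacci
  pattern that have no adjacent inversion across them are exactly the block boundaries.
\<close>

lemma fib_cut_at_block:
  assumes "fib_blocks \<alpha>s" "p \<le> length (fib \<alpha>s)"
    and "0 < p \<Longrightarrow> p < length (fib \<alpha>s) \<Longrightarrow> fib \<alpha>s ! (p - 1) < fib \<alpha>s ! p"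
  shows "\<exists>j \<le> length \<alpha>s. take p (fib \<alpha>s) = fib (take j \<alpha>s) \<and>
           drop p (fib \<alpha>s) = map (\<lambda>x. x + p) (fib (drop j \<alpha>s))"
  using assms
proof (induction \<alpha>s arbitrary: p)
  case Nil
  then show ?case by simp
next
  case (Cons \<alpha> \<alpha>s)
  consider "p = 0" | "0 < p" "p < length \<alpha>" | "length \<alpha> \<le> p" by linarith
  then show ?case
  proof cases
    case 1
    then show ?thesis by (intro exI[of _ 0]) simp
  next
    case 2
    then have "\<alpha> = [2, 1]" "p = 1" using Cons.prems(1) by auto
    then show ?thesis using Cons.prems(3) by (auto simp: direct_sum_nth)
  next
    case 3
    define q where "q = p - length \<alpha>"
    have p: "p = length \<alpha> + q" using 3 by (simp add: q_def)
    have "fib \<alpha>s ! (q - 1) < fib \<alpha>s ! q" if q: "0 < q" "q < length (fib \<alpha>s)"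
    proof -
      obtain q' where q': "q = Suc q'" using q(1) by (cases q) auto
      have "fib (\<alpha> # \<alpha>s) ! (p - 1) < fib (\<alpha> # \<alpha>s) ! p"
        using q by (intro Cons.prems(3)) (simp_all add: p)
      then show ?thesis using q by (simp add: p q' direct_sum_nth)
    qed
    then obtain j where j: "j \<le> length \<alpha>s" "take q (fib \<alpha>s) = fib (take j \<alpha>s)"
      "drop q (fib \<alpha>s) = map (\<lambda>x. x + q) (fib (drop j \<alpha>s))"
      using Cons.IH[of q] Cons.prems(1,2) by (auto simp: p)
    have "take p (fib (\<alpha> # \<alpha>s)) = fib (take (Suc j) (\<alpha> # \<alpha>s))"
      using j(2) by (simp add: p direct_sum_def take_map)
    moreover have "drop p (fib (\<alpha> # \<alpha>s)) = map (\<lambda>x. x + p) (fib (drop (Suc j) (\<alpha> # \<alpha>s)))"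
      using j(3) by (simp add: p direct_sum_def drop_map add_ac)
    ultimately show ?thesis using j(1) by (intro exI[of _ "Suc j"]) simp
  qed
qed

section \<open>Occurrences in a direct sum\<close>

lemma contains_Nil [simp]: "contains_pattern \<pi> []"
  by (auto simp: contains_pattern_def)

lemma contains_length: "contains_pattern \<pi> \<tau> \<Longrightarrow> length \<tau> \<le> length \<pi>"
proof -
  assume "contains_pattern \<pi> \<tau>"
  then obtain f where f: "strict_mono_on {..<length \<tau>} f" "f ` {..<length \<tau>} \<subseteq> {..<length \<pi>}"
    by (auto simp: contains_pattern_def)
  have "card {..<length \<tau>} \<le> card {..<length \<pi>}"
    using f strict_mono_on_imp_inj_on by (intro card_inj_on_le[of f]) auto
  then show ?thesis by simp
qed

lemma contains_shift [simp]:
  "contains_pattern \<pi> (map (\<lambda>x. x + c) \<tau>) \<longleftrightarrow> contains_pattern \<pi> \<tau>"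
proof -
  have "(\<forall>a < length \<tau>. \<forall>b < length \<tau>.
        \<pi> ! f a < \<pi> ! f b \<longleftrightarrow> map (\<lambda>x. x + c) \<tau> ! a < map (\<lambda>x. x + c) \<tau> ! b) \<longleftrightarrow>
      (\<forall>a < length \<tau>. \<forall>b < length \<tau>. \<pi> ! f a < \<pi> ! f b \<longleftrightarrow> \<tau> ! a < \<tau> ! b)" for f
    by auto
  then show ?thesis by (simp only: contains_pattern_def length_map)
qed

lemma contains_take: "contains_pattern \<pi> \<tau> \<Longrightarrow> contains_pattern \<pi> (take p \<tau>)"
  unfolding contains_pattern_def
  by (elim exE, rule_tac x = f in exI) (auto simp: strict_mono_on_def image_subset_iff)

lemma contains_drop:
  assumes "contains_pattern \<pi> \<tau>"
  shows "contains_pattern \<pi> (drop p \<tau>)"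
proof -
  obtain f where "strict_mono_on {..<length \<tau>} f" "f ` {..<length \<tau>} \<subseteq> {..<length \<pi>}"
    "\<forall>a < length \<tau>. \<forall>b < length \<tau>. \<pi> ! f a < \<pi> ! f b \<longleftrightarrow> \<tau> ! a < \<tau> ! b"
    using assms by (auto simp: contains_pattern_def)
  moreover from this(1) have "strict_mono_on {..<length (drop p \<tau>)} (\<lambda>i. f (p + i))"
    by (auto intro!: strict_mono_onI strict_mono_onD[of "{..<length \<tau>}" f])
  ultimately show ?thesis
    unfolding contains_pattern_def
    by (intro exI[of _ "\<lambda>i. f (p + i)"]) (auto simp: image_subset_iff)
qed

lemma contains_direct_sumI:
  assumes "is_permutation \<sigma>" "is_permutation \<rho>" "is_permutation \<tau>" "is_permutation \<upsilon>"
    and "contains_pattern \<sigma> \<tau>" "contains_pattern \<rho> \<upsilon>"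
  shows "contains_pattern (direct_sum \<sigma> \<rho>) (direct_sum \<tau> \<upsilon>)"
proof -
  obtain f where f: "strict_mono_on {..<length \<tau>} f" "\<And>i. i < length \<tau> \<Longrightarrow> f i < length \<sigma>"
    "\<And>a b. a < length \<tau> \<Longrightarrow> b < length \<tau> \<Longrightarrow> \<sigma> ! f a < \<sigma> ! f b \<longleftrightarrow> \<tau> ! a < \<tau> ! b"
    using assms(5) by (auto simp: contains_pattern_def image_subset_iff)
  obtain g where g: "strict_mono_on {..<length \<upsilon>} g" "\<And>i. i < length \<upsilon> \<Longrightarrow> g i < length \<rho>"
    "\<And>a b. a < length \<upsilon> \<Longrightarrow> b < length \<upsilon> \<Longrightarrow> \<rho> ! g a < \<rho> ! g b \<longleftrightarrow> \<upsilon> ! a < \<upsilon> ! b"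
    using assms(6) by (auto simp: contains_pattern_def image_subset_iff)
  define h where "h i = (if i < length \<tau> then f i else length \<sigma> + g (i - length \<tau>))" for i
  have bd: "h i < length \<sigma> + length \<rho>" if "i < length \<tau> + length \<upsilon>" for i
    using that f(2)[of i] g(2)[of "i - length \<tau>"] by (auto simp: h_def)
  have mono: "h i < h j" if "i < j" "j < length \<tau> + length \<upsilon>" for i j
  proof -
    consider "j < length \<tau>" | "i < length \<tau>" "length \<tau> \<le> j" | "length \<tau> \<le> i" by linarith
    then show ?thesis
    proof cases
      case 1
      then show ?thesis using that f(1) by (auto simp: h_def strict_mono_on_def)
    next
      case 2
      then show ?thesis using f(2)[of i] by (auto simp: h_def)
    next
      case 3
      then have "g (i - length \<tau>) < g (j - length \<tau>)"
        using that by (intro strict_mono_onD[OF g(1)]) auto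
      then show ?thesis using 3 that by (auto simp: h_def)
    qed
  qed
  have ord: "direct_sum \<sigma> \<rho> ! h a < direct_sum \<sigma> \<rho> ! h b \<longleftrightarrow>
      direct_sum \<tau> \<upsilon> ! a < direct_sum \<tau> \<upsilon> ! b"
    if "a < length \<tau> + length \<upsilon>" "b < length \<tau> + length \<upsilon>" for a b
  proof -
    have low: "direct_sum \<sigma> \<rho> ! h i = \<sigma> ! f i" "direct_sum \<tau> \<upsilon> ! i = \<tau> ! i"
      "\<sigma> ! f i \<le> length \<sigma>" "\<tau> ! i \<le> length \<tau>" if "i < length \<tau>" for i
      using that f(2)[of i] permutation_nth(2)[OF assms(1)] permutation_nth(2)[OF assms(3)]
      by (auto simp: direct_sum_nth h_def)
    have high: "direct_sum \<sigma> \<rho> ! h i = \<rho> ! g (i - length \<tau>) + length \<sigma>"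
      "direct_sum \<tau> \<upsilon> ! i = \<upsilon> ! (i - length \<tau>) + length \<tau>"
      "1 \<le> \<rho> ! g (i - length \<tau>)" "1 \<le> \<upsilon> ! (i - length \<tau>)"
      if "length \<tau> \<le> i" "i < length \<tau> + length \<upsilon>" for i
    proof -
      have i: "i - length \<tau> < length \<upsilon>" using that by linarith
      then show "1 \<le> \<rho> ! g (i - length \<tau>)" "1 \<le> \<upsilon> ! (i - length \<tau>)"
        using permutation_nth(1)[OF assms(2) g(2)] permutation_nth(1)[OF assms(4)] by blast+
      show "direct_sum \<tau> \<upsilon> ! i = \<upsilon> ! (i - length \<tau>) + length \<tau>"
        using that by (simp add: direct_sum_nth)
      show "direct_sum \<sigma> \<rho> ! h i = \<rho> ! g (i - length \<tau>) + length \<sigma>"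
        using that(1) g(2)[OF i] by (simp add: direct_sum_nth h_def)
    qed
    show ?thesis
    proof (cases "a < length \<tau>")
      case True
      show ?thesis
      proof (cases "b < length \<tau>")
        case True
        then show ?thesis using \<open>a < length \<tau>\<close> f(3)[of a b] by (simp add: low(1,2))
      next
        case False
        then show ?thesis using low[of a] high[of b] True that by linarith
      qed
    next
      case False
      show ?thesis
      proof (cases "b < length \<tau>")
        case True
        then show ?thesis using low[of b] high[of a] False that by linarith
      next
        case nb: False
        then have "(\<rho> ! g (a - length \<tau>) < \<rho> ! g (b - length \<tau>)) =
            (\<upsilon> ! (a - length \<tau>) < \<upsilon> ! (b - length \<tau>))"
          using False that by (intro g(3)) linarith+
        then show ?thesis
          using high(1,2)[of a] high(1,2)[of b] False nb that by simp
      qed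
    qed
  qed
  show ?thesis
    unfolding contains_pattern_def
    using bd mono ord by (intro exI[of _ h]) (auto simp: strict_mono_on_def image_subset_iff)
qed

text \<open>
  Positions in \<open>\<sigma>\<close> precede positions in \<open>\<rho>\<close>, so an occurrence uses \<open>\<sigma>\<close> for a prefix of the
  pattern. No inversion runs from \<open>\<sigma>\<close> to \<open>\<rho>\<close>, which is why the pattern must ascend at the cut.
\<close>

lemma contains_direct_sumE:
  assumes "is_permutation \<sigma>" "is_permutation \<rho>" "contains_pattern (direct_sum \<sigma> \<rho>) \<tau>"
  obtains p where "p \<le> length \<tau>" "contains_pattern \<sigma> (take p \<tau>)" "contains_pattern \<rho> (drop p \<tau>)"
    "0 < p \<Longrightarrow> p < length \<tau> \<Longrightarrow> \<tau> ! (p - 1) < \<tau> ! p"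
proof -
  let ?s = "length \<sigma>"
  obtain f where mono: "strict_mono_on {..<length \<tau>} f"
    and bd: "\<And>i. i < length \<tau> \<Longrightarrow> f i < ?s + length \<rho>"
    and ord: "\<And>a b. a < length \<tau> \<Longrightarrow> b < length \<tau> \<Longrightarrow>
      direct_sum \<sigma> \<rho> ! f a < direct_sum \<sigma> \<rho> ! f b \<longleftrightarrow> \<tau> ! a < \<tau> ! b"
    using assms(3) by (auto simp: contains_pattern_def image_subset_iff)
  \<comment> \<open>The first entry of the occurrence that lies in the second summand, if there is one.\<close>
  define p where "p = (LEAST p. length \<tau> \<le> p \<or> ?s \<le> f p)"
  have p: "length \<tau> \<le> p \<or> ?s \<le> f p"
    unfolding p_def by (rule LeastI_ex) auto
  have le: "p \<le> length \<tau>" unfolding p_def by (rule Least_le) simp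
  have below: "f i < ?s" if "i < p" for i
    using not_less_Least[of i, OF that[unfolded p_def]] by simp
  have above: "?s \<le> f i" if "p \<le> i" "i < length \<tau>" for i
  proof (cases "i = p")
    case False
    then have "f p < f i" using that by (intro strict_mono_onD[OF mono]) auto
    then show ?thesis using p that by linarith
  qed (use p that in auto)
  have left: "direct_sum \<sigma> \<rho> ! f i = \<sigma> ! f i" if "i < p" for i
    using below[OF that] by (simp add: direct_sum_nth)
  have right: "direct_sum \<sigma> \<rho> ! f i = \<rho> ! (f i - ?s) + ?s" if "p \<le> i" "i < length \<tau>" for i
    using above[OF that] bd[OF that(2)] by (simp add: direct_sum_nth)
  have 1: "contains_pattern \<sigma> (take p \<tau>)"
    unfolding contains_pattern_def
  proof (intro exI[of _ f] conjI allI impI)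
    show "strict_mono_on {..<length (take p \<tau>)} f"
      using mono by (auto simp: strict_mono_on_def)
    show "f ` {..<length (take p \<tau>)} \<subseteq> {..<length \<sigma>}"
      using below by auto
    fix a b assume "a < length (take p \<tau>)" "b < length (take p \<tau>)"
    then show "(\<sigma> ! f a < \<sigma> ! f b) = (take p \<tau> ! a < take p \<tau> ! b)"
      using ord[of a b] by (auto simp: left)
  qed
  have 2: "contains_pattern \<rho> (drop p \<tau>)"
    unfolding contains_pattern_def
  proof (intro exI[of _ "\<lambda>i. f (p + i) - ?s"] conjI allI impI)
    show "strict_mono_on {..<length (drop p \<tau>)} (\<lambda>i. f (p + i) - ?s)"
    proof (rule strict_mono_onI)
      fix i j assume ij: "i \<in> {..<length (drop p \<tau>)}" "j \<in> {..<length (drop p \<tau>)}" "i < j"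
      then have "f (p + i) < f (p + j)" by (intro strict_mono_onD[OF mono]) auto
      moreover have "?s \<le> f (p + i)" using above[of "p + i"] ij by auto
      ultimately show "f (p + i) - ?s < f (p + j) - ?s" by linarith
    qed
    show "(\<lambda>i. f (p + i) - ?s) ` {..<length (drop p \<tau>)} \<subseteq> {..<length \<rho>}"
    proof (intro image_subsetI)
      fix i assume "i \<in> {..<length (drop p \<tau>)}"
      then have "?s \<le> f (p + i)" "f (p + i) < ?s + length \<rho>"
        using above[of "p + i"] bd[of "p + i"] by auto
      then show "f (p + i) - ?s \<in> {..<length \<rho>}" by auto
    qed
    fix a b assume ab: "a < length (drop p \<tau>)" "b < length (drop p \<tau>)"
    then show "(\<rho> ! (f (p + a) - ?s) < \<rho> ! (f (p + b) - ?s)) = (drop p \<tau> ! a < drop p \<tau> ! b)"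
      using ord[of "p + a" "p + b"] by (auto simp: right)
  qed
  have 3: "\<tau> ! (p - 1) < \<tau> ! p" if "0 < p" "p < length \<tau>"
  proof -
    have "\<sigma> ! f (p - 1) \<le> ?s"
      using below[of "p - 1"] that permutation_nth(2)[OF assms(1)] by simp
    moreover have "1 \<le> \<rho> ! (f p - ?s)"
      using above[of p] bd[of p] that permutation_nth(1)[OF assms(2), of "f p - ?s"] by simp
    ultimately show ?thesis
      using ord[of "p - 1" p] left[of "p - 1"] right[of p] that by auto
  qed
  show thesis using that[OF le 1 2 3] .
qed

text \<open>
  The number of leading blocks that a greedy matching of the pattern consumes in \<open>\<sigma>\<close>.
\<close>

definition contained_blocks :: "nat list \<Rightarrow> nat list list \<Rightarrow> nat" where
  "contained_blocks \<sigma> \<alpha>s = (GREATEST j. j \<le> length \<alpha>s \<and> contains_pattern \<sigma> (fib (take j \<alpha>s)))"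

definition residual :: "nat list \<Rightarrow> nat list list \<Rightarrow> nat list list" where
  "residual \<sigma> \<alpha>s = drop (contained_blocks \<sigma> \<alpha>s) \<alpha>s"

lemma contained_blocks:
  shows contained_blocks_le: "contained_blocks \<sigma> \<alpha>s \<le> length \<alpha>s"
    and contains_contained_blocks: "contains_pattern \<sigma> (fib (take (contained_blocks \<sigma> \<alpha>s) \<alpha>s))"
  using GreatestI_nat[of "\<lambda>j. j \<le> length \<alpha>s \<and> contains_pattern \<sigma> (fib (take j \<alpha>s))" 0 "length \<alpha>s"]
  by (auto simp: contained_blocks_def)

lemma contained_blocks_ge:
  "j \<le> length \<alpha>s \<Longrightarrow> contains_pattern \<sigma> (fib (take j \<alpha>s)) \<Longrightarrow> j \<le> contained_blocks \<sigma> \<alpha>s"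
  unfolding contained_blocks_def by (rule Greatest_le_nat[where b = "length \<alpha>s"]) auto

lemma contains_fib_drop:
  assumes "contains_pattern \<pi> (fib \<alpha>s)"
  shows "contains_pattern \<pi> (fib (drop j \<alpha>s))"
proof -
  have "fib \<alpha>s = direct_sum (fib (take j \<alpha>s)) (fib (drop j \<alpha>s))"
    by (simp flip: fib_append)
  then have "drop (length (fib (take j \<alpha>s))) (fib \<alpha>s) =
      map (\<lambda>x. x + length (fib (take j \<alpha>s))) (fib (drop j \<alpha>s))"
    by (simp add: direct_sum_def)
  then show ?thesis using contains_drop[OF assms] by (metis contains_shift)
qed

lemma contains_fib_take:
  assumes "contains_pattern \<pi> (fib \<alpha>s)"
  shows "contains_pattern \<pi> (fib (take j \<alpha>s))"
proof -
  have "fib \<alpha>s = direct_sum (fib (take j \<alpha>s)) (fib (drop j \<alpha>s))"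
    by (simp flip: fib_append)
  then have "take (length (fib (take j \<alpha>s))) (fib \<alpha>s) = fib (take j \<alpha>s)"
    by (simp add: direct_sum_def)
  then show ?thesis using contains_take[OF assms] by metis
qed

text \<open>
  Greedy matching: an occurrence of a Fibonacci pattern in a direct sum splits at a block
  boundary, and moving that boundary to the right as far as the first summand permits only
  leaves less to find in the second one.
\<close>

lemma contains_direct_sum_iff_residual:
  assumes "is_permutation \<sigma>" "is_permutation \<rho>" "fib_blocks \<alpha>s"
  shows "contains_pattern (direct_sum \<sigma> \<rho>) (fib \<alpha>s) \<longleftrightarrow> contains_pattern \<rho> (fib (residual \<sigma> \<alpha>s))"
proof
  assume "contains_pattern (direct_sum \<sigma> \<rho>) (fib \<alpha>s)"
  then obtain p where p: "p \<le> length (fib \<alpha>s)" "contains_pattern \<sigma> (take p (fib \<alpha>s))"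
    "contains_pattern \<rho> (drop p (fib \<alpha>s))"
    "0 < p \<Longrightarrow> p < length (fib \<alpha>s) \<Longrightarrow> fib \<alpha>s ! (p - 1) < fib \<alpha>s ! p"
    using contains_direct_sumE[OF assms(1,2)] by metis
  obtain j where j: "j \<le> length \<alpha>s" "take p (fib \<alpha>s) = fib (take j \<alpha>s)"
    "drop p (fib \<alpha>s) = map (\<lambda>x. x + p) (fib (drop j \<alpha>s))"
    using fib_cut_at_block[OF assms(3) p(1,4)] by blast
  have le: "j \<le> contained_blocks \<sigma> \<alpha>s"
    using p(2) j by (intro contained_blocks_ge) auto
  have "contains_pattern \<rho> (fib (drop j \<alpha>s))" using p(3) j(3) by simp
  then have "contains_pattern \<rho> (fib (drop (contained_blocks \<sigma> \<alpha>s - j) (drop j \<alpha>s)))"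
    by (rule contains_fib_drop)
  then show "contains_pattern \<rho> (fib (residual \<sigma> \<alpha>s))"
    using le by (simp add: residual_def)
next
  let ?j = "contained_blocks \<sigma> \<alpha>s"
  assume "contains_pattern \<rho> (fib (residual \<sigma> \<alpha>s))"
  then have "contains_pattern (direct_sum \<sigma> \<rho>) (direct_sum (fib (take ?j \<alpha>s)) (fib (drop ?j \<alpha>s)))"
    using contains_contained_blocks assms
    by (intro contains_direct_sumI) (auto simp: residual_def permutation_fib)
  then show "contains_pattern (direct_sum \<sigma> \<rho>) (fib \<alpha>s)"
    by (simp flip: fib_append)
qed

text \<open>
  This makes inductions on the number of blocks possible: a summand that contains the first block
  shortens the pattern.
\<close>

lemma residual_Cons:
  assumes "contains_pattern \<sigma> \<alpha>"
  obtains j where "residual \<sigma> (\<alpha> # \<alpha>s) = drop j \<alpha>s"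
proof -
  have "1 \<le> contained_blocks \<sigma> (\<alpha> # \<alpha>s)"
    using assms by (intro contained_blocks_ge) auto
  then have "residual \<sigma> (\<alpha> # \<alpha>s) = drop (contained_blocks \<sigma> (\<alpha> # \<alpha>s) - 1) \<alpha>s"
    by (cases "contained_blocks \<sigma> (\<alpha> # \<alpha>s)") (auto simp: residual_def)
  then show thesis by (rule that)
qed

lemma residual_Cons_eq:
  assumes "contains_pattern \<sigma> \<alpha>"
    and "\<And>\<beta> \<beta>s. \<alpha>s = \<beta> # \<beta>s \<Longrightarrow> \<not> contains_pattern \<sigma> (direct_sum \<alpha> \<beta>)"
  shows "residual \<sigma> (\<alpha> # \<alpha>s) = \<alpha>s"
proof -
  let ?j = "contained_blocks \<sigma> (\<alpha> # \<alpha>s)"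
  have "1 \<le> ?j"
    using assms by (intro contained_blocks_ge) auto
  moreover have "\<not> 2 \<le> ?j"
  proof
    assume "2 \<le> ?j"
    moreover from this obtain \<beta> \<beta>s where "\<alpha>s = \<beta> # \<beta>s"
      using contained_blocks_le[of \<sigma> "\<alpha> # \<alpha>s"] by (cases \<alpha>s) auto
    ultimately show False
      using contains_fib_take[OF contains_contained_blocks[of \<sigma> "\<alpha> # \<alpha>s"], of 2] assms(2)
      by (auto simp: min_def numeral_2_eq_2)
  qed
  ultimately have "?j = 1" by linarith
  then show ?thesis by (simp add: residual_def)
qed

lemma residual_Cons_same:
  assumes "\<not> contains_pattern \<sigma> \<alpha>"
  shows "residual \<sigma> (\<alpha> # \<alpha>s) = \<alpha> # \<alpha>s"
proof -
  let ?j = "contained_blocks \<sigma> (\<alpha> # \<alpha>s)"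
  have "\<not> 1 \<le> ?j"
    using contains_fib_take[OF contains_contained_blocks[of \<sigma> "\<alpha> # \<alpha>s"], of 1] assms
    by (auto simp: min_def)
  then have "?j = 0" by linarith
  then show ?thesis by (simp add: residual_def)
qed

section \<open>The first indecomposable summand\<close>

definition indecomposable :: "nat list \<Rightarrow> bool" where
  "indecomposable \<beta> \<longleftrightarrow>
     is_permutation \<beta> \<and> \<beta> \<noteq> [] \<and> (\<forall>j. 0 < j \<longrightarrow> j < length \<beta> \<longrightarrow> set (take j \<beta>) \<noteq> {1..j})"

text \<open>
  If no inversion crossed the cut, the first entries would form a down-closed set of
  values, that is, an initial interval.
\<close>

lemma crossing_inversion:
  assumes \<beta>: "indecomposable \<beta>" and j: "0 < j" "j < length \<beta>"
  shows "\<exists>(a, b) \<in> inversions \<beta>. a < j \<and> j \<le> b"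
proof (rule ccontr)
  assume no: "\<not> ?thesis"
  have dist: "distinct \<beta>" and set: "set \<beta> = {1..length \<beta>}"
    using \<beta> by (auto simp: indecomposable_def is_permutation_def)
  have le: "\<beta> ! a \<le> \<beta> ! b" if "a < j" "j \<le> b" "b < length \<beta>" for a b
    using no that by (fastforce simp: inversions_def)
  let ?S = "set (take j \<beta>)"
  have card: "card ?S = j"
    using distinct_card[of "take j \<beta>"] dist j by simp
  have "?S \<subseteq> {1..j}"
  proof
    fix x assume x: "x \<in> ?S"
    then obtain a where a: "a < j" "x = \<beta> ! a"
      using j by (auto simp: in_set_conv_nth)
    have x_set: "x \<in> {1..length \<beta>}" using x set in_set_takeD by fast
    have "{1..x} \<subseteq> ?S"
    proof
      fix y assume y: "y \<in> {1..x}"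
      then have "y \<in> set \<beta>" using x_set set by auto
      then obtain b where b: "b < length \<beta>" "y = \<beta> ! b" by (auto simp: in_set_conv_nth)
      show "y \<in> ?S"
      proof (cases "b < j")
        case True
        then show ?thesis using b by (auto simp: in_set_conv_nth)
      next
        case False
        then have "x \<le> y" using le[of a b] a b by simp
        then show ?thesis using x y by simp
      qed
    qed
    then have "card {1..x} \<le> card ?S" by (intro card_mono) auto
    then show "x \<in> {1..j}" using card x_set by simp
  qed
  then have "?S = {1..j}" using card by (intro card_subset_eq) auto
  then show False using \<beta> j by (auto simp: indecomposable_def)
qed

text \<open>
  Every entry between the two ends of an inversion is smaller than the left end or
  larger than the right end, hence forms an inversion with one of them.
\<close>

lemma inversion_span:
  assumes "(a, b) \<in> inversions \<pi>"
  shows "b - a \<le> card (inversions \<pi>)"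
proof -
  have ab: "a < b" "b < length \<pi>" "\<pi> ! b < \<pi> ! a" using assms by (auto simp: inversions_def)
  let ?h = "\<lambda>c. if \<pi> ! c < \<pi> ! a then (a, c) else (c, b)"
  have "inj_on ?h {a<..b}" by (auto simp: inj_on_def)
  moreover have "?h ` {a<..b} \<subseteq> inversions \<pi>"
  proof
    fix p assume "p \<in> ?h ` {a<..b}"
    then obtain c where c: "a < c" "c \<le> b" "p = ?h c" by auto
    show "p \<in> inversions \<pi>"
    proof (cases "\<pi> ! c < \<pi> ! a")
      case True
      then show ?thesis using c ab by (auto simp: inversions_def)
    next
      case False
      then have "c \<noteq> b" using ab by auto
      then show ?thesis using False c ab by (auto simp: inversions_def)
    qed
  qed
  ultimately have "card {a<..b} \<le> card (inversions \<pi>)"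
    by (rule card_inj_on_le) simp
  then show ?thesis by simp
qed

text \<open>The spans of the inversions cover all cuts.\<close>

lemma length_indecomposable_le:
  assumes "indecomposable \<beta>"
  shows "length \<beta> \<le> card (inversions \<beta>) ^ 2 + 1"
proof -
  let ?I = "inversions \<beta>"
  have "{1..<length \<beta>} \<subseteq> (\<Union>(a, b) \<in> ?I. {a<..b})"
  proof
    fix j assume "j \<in> {1..<length \<beta>}"
    then have "\<exists>(a, b) \<in> ?I. a < j \<and> j \<le> b"
      using crossing_inversion[OF assms, of j] by simp
    then show "j \<in> (\<Union>(a, b) \<in> ?I. {a<..b})" by fastforce
  qed
  then have "card {1..<length \<beta>} \<le> card (\<Union>(a, b) \<in> ?I. {a<..b})"
    by (intro card_mono) auto
  also have "\<dots> \<le> (\<Sum>(a, b) \<in> ?I. card {a<..b})"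
    unfolding case_prod_beta by (rule card_UN_le) simp
  also have "\<dots> \<le> (\<Sum>p \<in> ?I. card ?I)"
    by (rule sum_mono) (auto dest: inversion_span)
  finally show ?thesis by (simp add: power2_eq_square)
qed

text \<open>
  The recursion below has finitely many terms, with an index set that does not grow with the
  length of the permutations.
\<close>

lemma finite_indecomposables: "finite {\<beta>. indecomposable \<beta> \<and> card (inversions \<beta>) \<le> k}"
proof (rule finite_subset)
  show "{\<beta>. indecomposable \<beta> \<and> card (inversions \<beta>) \<le> k} \<subseteq>
      {xs. set xs \<subseteq> {1..k ^ 2 + 1} \<and> length xs \<le> k ^ 2 + 1}"
  proof (intro subsetI CollectI)
    fix \<beta> assume \<beta>: "\<beta> \<in> {\<beta>. indecomposable \<beta> \<and> card (inversions \<beta>) \<le> k}"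
    then have "card (inversions \<beta>) ^ 2 \<le> k ^ 2" by (intro power_mono) auto
    then have "length \<beta> \<le> k ^ 2 + 1" using length_indecomposable_le[of \<beta>] \<beta>
      by (metis (no_types, lifting) add_le_mono1 mem_Collect_eq order_trans)
    moreover have "set \<beta> = {1..length \<beta>}"
      using \<beta> by (simp add: indecomposable_def is_permutation_def)
    ultimately show "set \<beta> \<subseteq> {1..k ^ 2 + 1} \<and> length \<beta> \<le> k ^ 2 + 1" by simp
  qed
  show "finite {xs::nat list. set xs \<subseteq> {1..k ^ 2 + 1} \<and> length xs \<le> k ^ 2 + 1}"
    by (rule finite_lists_length_le) simp
qed

lemma contains_21:
  assumes "inversions \<pi> \<noteq> {}"
  shows "contains_pattern \<pi> [2, 1]"
proof -
  obtain a b where ab: "a < b" "b < length \<pi>" "\<pi> ! b < \<pi> ! a"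
    using assms by (auto simp: inversions_def)
  then show ?thesis
    unfolding contains_pattern_def
    by (intro exI[of _ "\<lambda>i. if i = 0 then a else b"])
      (auto simp: strict_mono_on_def less_Suc_eq numeral_2_eq_2)
qed

lemma indecomposable_contains_21:
  assumes "indecomposable \<beta>" "\<beta> \<noteq> [1]"
  shows "contains_pattern \<beta> [2, 1]"
proof -
  have "1 < length \<beta>"
  proof (rule ccontr)
    assume "\<not> 1 < length \<beta>"
    then obtain x where x: "\<beta> = [x]"
      using assms(1) by (cases \<beta>) (auto simp: indecomposable_def)
    then have "{x} = {1::nat}" using assms(1) by (simp add: indecomposable_def is_permutation_def)
    then show False using x assms(2) by simp
  qed
  then show ?thesis
    using crossing_inversion[OF assms(1), of 1] by (intro contains_21) auto
qed

text \<open>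
  The summand ends at the first cut, that is, after the shortest nonempty prefix that is itself
  a permutation.
\<close>

lemma indecomposable_summand_exists:
  assumes \<pi>: "is_permutation \<pi>" "\<pi> \<noteq> []"
  obtains \<beta> \<rho> where "indecomposable \<beta>" "is_permutation \<rho>" "\<pi> = direct_sum \<beta> \<rho>"
proof -
  let ?Q = "\<lambda>m. 0 < m \<and> set (take m \<pi>) = {1..m}"
  define m where "m = (LEAST m. ?Q m)"
  have Q: "?Q (length \<pi>)" using \<pi> by (simp add: is_permutation_def)
  have m: "0 < m" "set (take m \<pi>) = {1..m}"
    using LeastI[of ?Q, OF Q] by (simp_all add: m_def)
  have le: "m \<le> length \<pi>" unfolding m_def by (rule Least_le) (rule Q)
  have least: "set (take j \<pi>) \<noteq> {1..j}" if "0 < j" "j < m" for j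
    using not_less_Least[of j ?Q] that by (auto simp: m_def)
  have dist: "distinct \<pi>" and set: "set \<pi> = {1..length \<pi>}"
    using \<pi> by (auto simp: is_permutation_def)
  have 1: "indecomposable (take m \<pi>)"
    using m le least dist \<pi>(2) by (auto simp: indecomposable_def is_permutation_def min_def)
  have "set (take m \<pi>) \<union> set (drop m \<pi>) = {1..length \<pi>}"
    by (metis append_take_drop_id set set_append)
  moreover have "set (take m \<pi>) \<inter> set (drop m \<pi>) = {}"
    using dist by (rule set_take_disj_set_drop_if_distinct) simp
  ultimately have "set (drop m \<pi>) = {1..length \<pi>} - {1..m}"
    using m(2) by blast
  also have "\<dots> = {1 + m..(length \<pi> - m) + m}" using le by auto
  finally have drop: "set (drop m \<pi>) = {1 + m..(length \<pi> - m) + m}" .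
  define \<rho> where "\<rho> = map (\<lambda>x. x - m) (drop m \<pi>)"
  have shift: "map (\<lambda>x. x + m) \<rho> = drop m \<pi>"
    unfolding \<rho>_def map_map by (rule map_idI) (use drop in auto)
  have "distinct \<rho>"
    using shift dist by (metis distinct_drop distinct_map)
  moreover have "set \<rho> = {1..length \<pi> - m}"
  proof -
    have "(\<lambda>x. x + m) ` set \<rho> = (\<lambda>x. x + m) ` {1..length \<pi> - m}"
      using shift drop by (metis image_add_atLeastAtMost' set_map)
    then show ?thesis by (subst (asm) inj_image_eq_iff) (auto simp: inj_def)
  qed
  ultimately have 2: "is_permutation \<rho>" by (simp add: is_permutation_def \<rho>_def)
  have 3: "\<pi> = direct_sum (take m \<pi>) \<rho>"
    using shift le by (simp add: direct_sum_def min_def)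
  show thesis using that[OF 1 2 3] .
qed

text \<open>
  If one summand were shorter, it would be a proper prefix of the other one and thus cut it.
\<close>

lemma indecomposable_summand_unique:
  assumes "indecomposable \<beta>" "indecomposable \<beta>'" "direct_sum \<beta> \<rho> = direct_sum \<beta>' \<rho>'"
  shows "\<beta> = \<beta>'" "\<rho> = \<rho>'"
proof -
  have le: "length \<gamma>' \<le> length \<gamma>"
    if "indecomposable \<gamma>" "indecomposable \<gamma>'" "direct_sum \<gamma> \<sigma> = direct_sum \<gamma>' \<sigma>'" for \<gamma> \<gamma>' \<sigma> \<sigma>'
  proof (rule ccontr)
    assume less: "\<not> length \<gamma>' \<le> length \<gamma>"
    have "\<gamma> = take (length \<gamma>) (direct_sum \<gamma> \<sigma>)" by (simp add: direct_sum_def)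
    also have "\<dots> = take (length \<gamma>) \<gamma>'"
      using less by (simp add: that(3)) (simp add: direct_sum_def)
    finally have "set (take (length \<gamma>) \<gamma>') = {1..length \<gamma>}"
      using that(1) by (metis indecomposable_def is_permutation_def)
    moreover have "0 < length \<gamma>" using that(1) by (simp add: indecomposable_def)
    ultimately show False using that(2) less by (auto simp: indecomposable_def)
  qed
  have len: "length \<beta> = length \<beta>'"
    using le[OF assms] le[OF assms(2,1) assms(3)[symmetric]] by simp
  then have "\<beta> = \<beta>' \<and> map (\<lambda>x. x + length \<beta>) \<rho> = map (\<lambda>x. x + length \<beta>) \<rho>'"
    using assms(3) by (simp add: direct_sum_def)
  then show "\<beta> = \<beta>'" "\<rho> = \<rho>'"
    using inj_map_eq_map[of "\<lambda>x. x + length \<beta>" \<rho> \<rho>'] by (auto simp: inj_def)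
qed

section \<open>The recursion for the number of avoiders\<close>

definition avoiders :: "nat \<Rightarrow> nat \<Rightarrow> nat list list \<Rightarrow> nat list set" where
  "avoiders n k \<alpha>s = {\<pi>. is_permutation \<pi> \<and> length \<pi> = n \<and>
     avoids_pattern \<pi> (fib \<alpha>s) \<and> card (inversions \<pi>) = k}"

lemma avoiders_count_eq: "avoiders_count n k (fib \<alpha>s) = card (avoiders n k \<alpha>s)"
  unfolding avoiders_count_def avoiders_def by (simp only: mem_permutations_iff conj_assoc)

lemma finite_avoiders: "finite (avoiders n k \<alpha>s)"
  by (rule finite_subset[of _ "permutations_of_set {1..n}"])
    (auto simp only: avoiders_def mem_permutations_iff finite_permutations_of_set mem_Collect_eq)

text \<open>
  Splitting off the first indecomposable summand is a bijection, and by greedy matching the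
  condition on the remainder is again avoidance of a Fibonacci pattern.
\<close>

lemma avoiders_count_rec:
  assumes "fib_blocks \<alpha>s" "0 < n"
  shows "avoiders_count n k (fib \<alpha>s) =
    (\<Sum>\<beta> | indecomposable \<beta> \<and> card (inversions \<beta>) \<le> k \<and> length \<beta> \<le> n.
       avoiders_count (n - length \<beta>) (k - card (inversions \<beta>)) (fib (residual \<beta> \<alpha>s)))"
proof -
  let ?B = "{\<beta>. indecomposable \<beta> \<and> card (inversions \<beta>) \<le> k \<and> length \<beta> \<le> n}"
  let ?R = "\<lambda>\<beta>. avoiders (n - length \<beta>) (k - card (inversions \<beta>)) (residual \<beta> \<alpha>s)"
  have perm: "is_permutation \<beta>" if "indecomposable \<beta>" for \<beta>
    using that by (simp add: indecomposable_def)
  have "bij_betw (\<lambda>(\<beta>, \<rho>). direct_sum \<beta> \<rho>) (SIGMA \<beta>:?B. ?R \<beta>) (avoiders n k \<alpha>s)"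
  proof (rule bij_betw_imageI)
    show "inj_on (\<lambda>(\<beta>, \<rho>). direct_sum \<beta> \<rho>) (SIGMA \<beta>:?B. ?R \<beta>)"
      by (auto intro!: inj_onI dest: indecomposable_summand_unique)
    show "(\<lambda>(\<beta>, \<rho>). direct_sum \<beta> \<rho>) ` (SIGMA \<beta>:?B. ?R \<beta>) = avoiders n k \<alpha>s"
    proof (intro equalityI subsetI)
      fix \<pi> assume "\<pi> \<in> (\<lambda>(\<beta>, \<rho>). direct_sum \<beta> \<rho>) ` (SIGMA \<beta>:?B. ?R \<beta>)"
      then obtain \<beta> \<rho> where "\<beta> \<in> ?B" "\<rho> \<in> ?R \<beta>" "\<pi> = direct_sum \<beta> \<rho>" by auto
      then show "\<pi> \<in> avoiders n k \<alpha>s"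
        using assms(1) perm[of \<beta>]
        by (simp add: avoiders_def permutation_direct_sum card_inversions_direct_sum
            contains_direct_sum_iff_residual)
    next
      fix \<pi> assume \<pi>: "\<pi> \<in> avoiders n k \<alpha>s"
      then have "is_permutation \<pi>" "\<pi> \<noteq> []" using assms(2) by (auto simp: avoiders_def)
      then obtain \<beta> \<rho> where *: "indecomposable \<beta>" "is_permutation \<rho>" "\<pi> = direct_sum \<beta> \<rho>"
        by (rule indecomposable_summand_exists)
      then have "\<beta> \<in> ?B" "\<rho> \<in> ?R \<beta>"
        using \<pi> assms(1) perm[of \<beta>]
        by (auto simp: avoiders_def card_inversions_direct_sum contains_direct_sum_iff_residual)
      then show "\<pi> \<in> (\<lambda>(\<beta>, \<rho>). direct_sum \<beta> \<rho>) ` (SIGMA \<beta>:?B. ?R \<beta>)"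
        using *(3) by force
    qed
  qed
  then have "card (SIGMA \<beta>:?B. ?R \<beta>) = card (avoiders n k \<alpha>s)"
    by (rule bij_betw_same_card)
  moreover have "finite ?B"
    by (rule finite_subset[OF _ finite_indecomposables[of k]]) auto
  ultimately show ?thesis
    by (simp add: avoiders_count_eq card_SigmaI finite_avoiders)
qed

lemma indecomposable_1: "indecomposable [1]" and inversions_1: "inversions [1] = {}"
  by (auto simp: indecomposable_def is_permutation_def inversions_def)

lemma residual_1:
  assumes "fib_blocks \<alpha>s"
  shows "residual [1] ([1] # \<alpha>s) = \<alpha>s" "residual [1] ([2, 1] # \<alpha>s) = [2, 1] # \<alpha>s"
proof -
  show "residual [1] ([1] # \<alpha>s) = \<alpha>s"
  proof (rule residual_Cons_eq)
    show "contains_pattern [1] [1]" by (auto simp: contains_pattern_def strict_mono_on_def)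
    fix \<beta> \<beta>s assume "\<alpha>s = \<beta> # \<beta>s"
    then have "\<beta> \<noteq> []" using assms by auto
    then show "\<not> contains_pattern [1] (direct_sum [1] \<beta>)"
      using contains_length[of "[1]" "direct_sum [1] \<beta>"] by auto
  qed
  show "residual [1] ([2, 1] # \<alpha>s) = [2, 1] # \<alpha>s"
    by (rule residual_Cons_same) (auto dest: contains_length)
qed

text \<open>
  Beyond \<open>k\<^sup>2\<close>, the length \<open>n\<close> no longer restricts which summands occur. The trivial
  summand is set apart because it is the only one that need not shorten the pattern.
\<close>

lemma avoiders_count_rec_large:
  assumes "fib_blocks \<alpha>s" "k ^ 2 < n"
  shows "avoiders_count n k (fib \<alpha>s) =
    avoiders_count (n - 1) k (fib (residual [1] \<alpha>s)) +
    (\<Sum>\<beta> | indecomposable \<beta> \<and> card (inversions \<beta>) \<le> k \<and> \<beta> \<noteq> [1].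
       avoiders_count (n - length \<beta>) (k - card (inversions \<beta>)) (fib (residual \<beta> \<alpha>s)))"
proof -
  let ?B = "{\<beta>. indecomposable \<beta> \<and> card (inversions \<beta>) \<le> k \<and> \<beta> \<noteq> [1]}"
  have "length \<beta> \<le> n" if "indecomposable \<beta>" "card (inversions \<beta>) \<le> k" for \<beta>
  proof -
    have "card (inversions \<beta>) ^ 2 \<le> k ^ 2" using that(2) by (rule power_mono) simp
    then show ?thesis using length_indecomposable_le[OF that(1)] assms(2) by linarith
  qed
  then have eq: "{\<beta>. indecomposable \<beta> \<and> card (inversions \<beta>) \<le> k \<and> length \<beta> \<le> n} = insert [1] ?B"
    using indecomposable_1 inversions_1 assms(2) by auto
  have "finite ?B"
    by (rule finite_subset[OF _ finite_indecomposables[of k]]) auto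
  moreover have "0 < n" using assms(2) by simp
  ultimately show ?thesis
    unfolding avoiders_count_rec[OF assms(1) \<open>0 < n\<close>] eq
    using inversions_1 by (subst sum.insert) auto
qed

section \<open>Functions that are eventually polynomial\<close>

text \<open>
  The coefficient condition says that the degree is less than \<open>d\<close>; unlike an inequality for
  \<open>degree\<close>, it forces the zero polynomial when \<open>d = 0\<close>, which is what patterns without a
  block 21 require.
\<close>

definition eventually_poly :: "nat \<Rightarrow> (nat \<Rightarrow> nat) \<Rightarrow> bool" where
  "eventually_poly d f \<longleftrightarrow> (\<exists>P :: real poly. (\<forall>i\<ge>d. coeff P i = 0) \<and>
     (\<forall>\<^sub>F n in sequentially. real (f n) = poly P (real n)))"

lemma eventually_poly_zero: "eventually_poly d (\<lambda>n. 0)"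
  unfolding eventually_poly_def by (intro exI[of _ 0]) simp

lemma eventually_poly_mono: "eventually_poly d f \<Longrightarrow> d \<le> d' \<Longrightarrow> eventually_poly d' f"
  unfolding eventually_poly_def by (meson order_trans)

lemma eventually_poly_cong:
  assumes "eventually_poly d f" "\<forall>\<^sub>F n in sequentially. g n = f n"
  shows "eventually_poly d g"
proof -
  obtain P :: "real poly" where P: "\<forall>i\<ge>d. coeff P i = 0"
    "\<forall>\<^sub>F n in sequentially. real (f n) = poly P (real n)"
    using assms(1) by (auto simp: eventually_poly_def)
  from P(2) assms(2) have "\<forall>\<^sub>F n in sequentially. real (g n) = poly P (real n)"
    by eventually_elim simp
  then show ?thesis using P(1) by (auto simp: eventually_poly_def)
qed

lemma eventually_poly_add:
  assumes "eventually_poly d f" "eventually_poly d g"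
  shows "eventually_poly d (\<lambda>n. f n + g n)"
proof -
  obtain P Q :: "real poly" where PQ: "\<forall>i\<ge>d. coeff P i = 0" "\<forall>i\<ge>d. coeff Q i = 0"
    "\<forall>\<^sub>F n in sequentially. real (f n) = poly P (real n)"
    "\<forall>\<^sub>F n in sequentially. real (g n) = poly Q (real n)"
    using assms by (auto simp: eventually_poly_def)
  from PQ(3,4) have "\<forall>\<^sub>F n in sequentially. real (f n + g n) = poly (P + Q) (real n)"
    by eventually_elim simp
  then show ?thesis using PQ(1,2) unfolding eventually_poly_def by (intro exI[of _ "P + Q"]) simp
qed

lemma eventually_poly_sum:
  "(\<And>x. x \<in> A \<Longrightarrow> eventually_poly d (f x)) \<Longrightarrow> eventually_poly d (\<lambda>n. \<Sum>x\<in>A. f x n)"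
  by (induction A rule: infinite_finite_induct)
    (auto simp: eventually_poly_zero intro!: eventually_poly_add)

lemma coeff_pcompose_shift:
  fixes P :: "real poly"
  assumes "\<forall>i\<ge>d. coeff P i = 0"
  shows "\<forall>i\<ge>d. coeff (pcompose P [:c, 1:]) i = 0"
proof (cases "P = 0")
  case False
  then have "degree P < d" using assms by (meson leading_coeff_0_iff not_le)
  then show ?thesis by (auto intro!: coeff_eq_0 simp: degree_pcompose)
qed simp

lemma eventually_poly_shift:
  assumes "eventually_poly d f"
  shows "eventually_poly d (\<lambda>n. f (n - m))"
proof -
  obtain P :: "real poly" where P: "\<forall>i\<ge>d. coeff P i = 0"
    "\<forall>\<^sub>F n in sequentially. real (f n) = poly P (real n)"
    using assms by (auto simp: eventually_poly_def)
  then obtain N where N: "\<And>n. n \<ge> N \<Longrightarrow> real (f n) = poly P (real n)"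
    by (auto simp: eventually_sequentially)
  have "real (f (n - m)) = poly (pcompose P [:- real m, 1:]) (real n)" if "n \<ge> N + m" for n
    using that N[of "n - m"] by (simp add: poly_pcompose of_nat_diff)
  then have "\<forall>\<^sub>F n in sequentially. real (f (n - m)) = poly (pcompose P [:- real m, 1:]) (real n)"
    unfolding eventually_sequentially by blast
  then show ?thesis
    using coeff_pcompose_shift[OF P(1)] unfolding eventually_poly_def by blast
qed

text \<open>
  The difference of \<open>x\<^sup>d\<^sup>+\<^sup>1\<close> has leading term \<open>(d + 1) x\<^sup>d\<close>, which allows one to cancel
  the top coefficient.
\<close>

lemma poly_antidifference:
  fixes Q :: "real poly"
  assumes "\<forall>i\<ge>d. coeff Q i = 0"
  shows "\<exists>P. (\<forall>i\<ge>Suc d. coeff P i = 0) \<and> (\<forall>x. poly P (x + 1) = poly P x + poly Q x)"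
  using assms
proof (induction d arbitrary: Q)
  case 0
  then have "Q = 0" by (simp add: poly_eq_iff)
  then show ?case by (intro exI[of _ 0]) simp
next
  case (Suc d)
  define a where "a = coeff Q d / real (Suc d)"
  define D where "D = smult a ([:1, 1:] ^ Suc d - monom 1 (Suc d))"
  have D: "coeff D i = (if i = Suc d then 0 else a * real (Suc d choose i))" for i
  proof (cases "i \<le> Suc d")
    case True
    then show ?thesis
      by (simp only: D_def coeff_smult coeff_diff coeff_monom coeff_linear_poly_power) auto
  next
    case False
    have "degree ([:1, 1:] ^ Suc d :: real poly) \<le> 1 * Suc d"
      using degree_power_le[of "[:1, 1::real:]" "Suc d"] by simp
    then have "coeff ([:1, 1:] ^ Suc d :: real poly) i = 0" using False by (intro coeff_eq_0) simp
    then show ?thesis using False by (simp add: D_def binomial_eq_0 del: power_Suc)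
  qed
  have "coeff (Q - D) i = 0" if i: "i \<ge> d" for i
  proof -
    consider "i = d" | "i = Suc d" | "i > Suc d" using i by linarith
    then show ?thesis
    proof cases
      case 1
      then show ?thesis by (simp add: D a_def binomial_Suc_n)
    qed (use Suc.prems in \<open>auto simp: D\<close>)
  qed
  then obtain P where P: "\<forall>i\<ge>Suc d. coeff P i = 0"
    "\<And>x. poly P (x + 1) = poly P x + poly (Q - D) x"
    using Suc.IH[of "Q - D"] by blast
  have "poly (P + monom a (Suc d)) (x + 1) = poly (P + monom a (Suc d)) x + poly Q x" for x
  proof -
    have "poly D x = a * (x + 1) ^ Suc d - a * x ^ Suc d"
      by (simp only: D_def poly_smult poly_diff poly_power poly_monom)
        (simp add: algebra_simps)
    then show ?thesis using P(2)[of x] by (simp add: poly_monom del: power_Suc)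
  qed
  moreover have "\<forall>i\<ge>Suc (Suc d). coeff (P + monom a (Suc d)) i = 0"
    using P(1) by simp
  ultimately show ?case by blast
qed

lemma eventually_poly_partial_sums:
  assumes "eventually_poly d g" "\<forall>\<^sub>F n in sequentially. f (Suc n) = f n + g (Suc n)"
  shows "eventually_poly (Suc d) f"
proof -
  obtain Q :: "real poly" where Q: "\<forall>i\<ge>d. coeff Q i = 0"
    "\<forall>\<^sub>F n in sequentially. real (g n) = poly Q (real n)"
    using assms by (auto simp: eventually_poly_def)
  obtain N where N: "\<And>n. n \<ge> N \<Longrightarrow> f (Suc n) = f n + g (Suc n)"
    "\<And>n. n \<ge> N \<Longrightarrow> real (g n) = poly Q (real n)"
    using assms(2) Q(2) unfolding eventually_sequentially
    by (metis (no_types, lifting) le_trans nle_le)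
  obtain P where P: "\<forall>i\<ge>Suc d. coeff P i = 0"
    "\<And>x. poly P (x + 1) = poly P x + poly (pcompose Q [:1, 1:]) x"
    using poly_antidifference[OF coeff_pcompose_shift[OF Q(1)]] by blast
  define c where "c = real (f N) - poly P (real N)"
  have "real (f n) = poly (P + [:c:]) (real n)" if "n \<ge> N" for n
    using that
  proof (induction n rule: dec_induct)
    case base
    then show ?case by (simp add: c_def)
  next
    case (step n)
    then show ?case
      using N(1)[of n] N(2)[of "Suc n"] P(2)[of "real n"]
      by (simp add: poly_pcompose add.commute)
  qed
  moreover have "\<forall>i\<ge>Suc d. coeff (P + [:c:]) i = 0"
    using P(1) by (simp add: coeff_pCons split: nat.split)
  ultimately show ?thesis
    unfolding eventually_poly_def eventually_sequentially by blast
qed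

text \<open>
  Otherwise \<open>P\<close> would be bounded by a multiple of \<open>x\<^bsup>d-1\<^esup>\<close>, while \<open>x choose d\<close> is at
  least \<open>(x/d)\<^bsup>d\<^esup>\<close>.
\<close>

lemma binomial_growth_coeff_nonzero:
  fixes P :: "real poly"
  assumes P: "\<forall>i\<ge>Suc d. coeff P i = 0"
    and growth: "\<And>x. x \<ge> N \<Longrightarrow> real (x choose d) \<le> poly P (real (x + m))"
  shows "coeff P d \<noteq> 0"
proof
  assume "coeff P d = 0"
  then have "\<forall>i\<ge>d. coeff P i = 0" using P by (metis le_antisym not_less_eq_eq)
  then have Q0: "\<forall>i\<ge>d. coeff (pcompose P [:real m, 1:]) i = 0" by (rule coeff_pcompose_shift)
  define Q where "Q = pcompose P [:real m, 1:]"
  have Q: "\<forall>i\<ge>d. coeff Q i = 0" using Q0 by (simp add: Q_def)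
  have Qx: "real (x choose d) \<le> poly Q (real x)" if "x \<ge> N" for x
    using growth[OF that] by (simp add: Q_def poly_pcompose add.commute)
  show False
  proof (cases d)
    case 0
    then have "Q = 0" using Q by (simp add: poly_eq_iff)
    then show False using Qx[of N] 0 by simp
  next
    case (Suc e)
    define C where "C = (\<Sum>i\<le>degree Q. \<bar>coeff Q i\<bar>)"
    have bound: "poly Q (real x) \<le> C * real x ^ e" if "x \<ge> 1" for x
    proof -
      have "poly Q (real x) = (\<Sum>i\<le>degree Q. coeff Q i * real x ^ i)"
        by (rule poly_altdef)
      also have "\<dots> \<le> (\<Sum>i\<le>degree Q. \<bar>coeff Q i\<bar> * real x ^ e)"
      proof (rule sum_mono)
        fix i
        show "coeff Q i * real x ^ i \<le> \<bar>coeff Q i\<bar> * real x ^ e"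
        proof (cases "i < d")
          case True
          then have "real x ^ i \<le> real x ^ e" using that Suc by (intro power_increasing) auto
          then show ?thesis by (intro mult_mono) auto
        qed (use Q in simp)
      qed
      finally show ?thesis by (simp add: C_def sum_distrib_right)
    qed
    \<comment> \<open>Large enough to violate the inequality \<open>x \<le> C d\<^bsup>d\<^esup>\<close> that the two bounds force.\<close>
    define x where "x = Suc (N + d + nat \<lceil>C * real d ^ d\<rceil>)"
    have x: "x \<ge> N" "x \<ge> 1" "x \<ge> d" by (auto simp: x_def)
    have "(real x / real d) ^ d \<le> real (x choose d)"
      using binomial_ge_n_over_k_pow_k[of d x, where ?'a = real] x by simp
    also have "\<dots> \<le> C * real x ^ e" using Qx[OF x(1)] bound[OF x(2)] by simp
    finally have "real x ^ d \<le> C * real d ^ d * real x ^ e"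
      using Suc by (simp add: power_divide pos_divide_le_eq mult_ac del: power_Suc of_nat_Suc)
    then have "real x * real x ^ e \<le> (C * real d ^ d) * real x ^ e" by (simp add: Suc)
    then have "real x \<le> C * real d ^ d" using x(2) by (simp add: mult_le_cancel_right)
    moreover have "C * real d ^ d < real x" unfolding x_def by linarith
    ultimately show False by simp
  qed
qed

section \<open>Polynomial upper bound\<close>

lemma count_list_drop_le: "count_list (drop j xs) x \<le> count_list xs x"
  by (metis append_take_drop_id count_list_append le_add2)

text \<open>
  The degree bound is proved for all \<open>k\<close> at once, since nontrivial summands use up
  inversions. Only a leading block 21 can raise the degree: there the trivial summand reproduces the
  pattern, and the recursion describes a sequence by its differences.
\<close>

theorem avoiders_count_eventually_poly:
  assumes "fib_blocks \<alpha>s"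
  shows "eventually_poly (count_list \<alpha>s [2, 1]) (\<lambda>n. avoiders_count n k (fib \<alpha>s))"
  using assms
proof (induction \<alpha>s arbitrary: k rule: length_induct)
  case hyp: (1 \<alpha>s)
  show ?case
  proof (cases \<alpha>s)
    case Nil
    then show ?thesis by (simp add: avoiders_count_def eventually_poly_zero)
  next
    case (Cons \<alpha> \<alpha>s')
    let ?B = "{\<beta>. indecomposable \<beta> \<and> card (inversions \<beta>) \<le> k \<and> \<beta> \<noteq> [1]}"
    define g where "g n = (\<Sum>\<beta>\<in>?B. avoiders_count (n - length \<beta>) (k - card (inversions \<beta>))
      (fib (residual \<beta> \<alpha>s)))" for n
    have tail: "eventually_poly (count_list \<alpha>s' [2, 1]) (\<lambda>n. avoiders_count n k' (fib (drop j \<alpha>s')))"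
      for j k'
    proof -
      have "eventually_poly (count_list (drop j \<alpha>s') [2, 1])
          (\<lambda>n. avoiders_count n k' (fib (drop j \<alpha>s')))"
        using hyp Cons by (intro hyp(1)[rule_format]) auto
      then show ?thesis by (rule eventually_poly_mono) (rule count_list_drop_le)
    qed
    have g: "eventually_poly (count_list \<alpha>s' [2, 1]) g"
      unfolding g_def
    proof (intro eventually_poly_sum)
      fix \<beta> assume "\<beta> \<in> ?B"
      then have c21: "contains_pattern \<beta> [2, 1]" using indecomposable_contains_21 by blast
      then have "contains_pattern \<beta> \<alpha>"
        using contains_drop[OF c21, of 1] hyp(2) Cons by auto
      then obtain j where j: "residual \<beta> \<alpha>s = drop j \<alpha>s'"
        unfolding Cons by (rule residual_Cons)
      show "eventually_poly (count_list \<alpha>s' [2, 1]) (\<lambda>n. avoiders_count (n - length \<beta>)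
          (k - card (inversions \<beta>)) (fib (residual \<beta> \<alpha>s)))"
        unfolding j by (rule eventually_poly_shift) (rule tail)
    qed
    have rec: "\<forall>\<^sub>F n in sequentially. avoiders_count n k (fib \<alpha>s) =
        avoiders_count (n - 1) k (fib (residual [1] \<alpha>s)) + g n"
      using eventually_gt_at_top[of "k ^ 2"]
      by eventually_elim (simp only: avoiders_count_rec_large[OF hyp(2)] g_def)
    consider "\<alpha> = [1]" | "\<alpha> = [2, 1]" using hyp(2) Cons by auto
    then show ?thesis
    proof cases
      case 1
      have "residual [1] \<alpha>s = \<alpha>s'"
        using residual_1(1)[of \<alpha>s'] 1 Cons hyp(2) by simp
      then have rec': "\<forall>\<^sub>F n in sequentially. avoiders_count n k (fib \<alpha>s) =
          avoiders_count (n - 1) k (fib \<alpha>s') + g n"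
        using rec by simp
      have "eventually_poly (count_list \<alpha>s' [2, 1]) (\<lambda>n. avoiders_count (n - 1) k (fib \<alpha>s'))"
        using eventually_poly_shift[OF tail[of k 0]] by simp
      from eventually_poly_cong[OF eventually_poly_add[OF this g] rec']
      show ?thesis using 1 Cons by simp
    next
      case 2
      have "residual [1] \<alpha>s = \<alpha>s"
        using residual_1(2)[of \<alpha>s'] 2 Cons hyp(2) by simp
      then have "\<forall>\<^sub>F n in sequentially. avoiders_count (Suc n) k (fib \<alpha>s) =
          avoiders_count n k (fib \<alpha>s) + g (Suc n)"
        using iffD2[OF eventually_sequentially_Suc rec] by simp
      from eventually_poly_partial_sums[OF g this]
      show ?thesis using 2 Cons by simp
    qed
  qed
qed

section \<open>Lower bound on the growth\<close>

text \<open>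
  The permutation \<open>(j+1) 1 2 \<dots> j\<close>: it can absorb any number \<open>j\<close> of inversions, while all of them
  share their first entry, which is the maximum. So no entry lies to the left of
  a 21 in it, and none above.
\<close>

definition top_first :: "nat \<Rightarrow> nat list" where
  "top_first j = Suc j # [1..<Suc j]"

lemma length_top_first [simp]: "length (top_first j) = Suc j"
  by (simp add: top_first_def)

lemma top_first_nth:
  "top_first j ! 0 = Suc j" "0 < i \<Longrightarrow> i \<le> j \<Longrightarrow> top_first j ! i = i"
  by (auto simp: top_first_def nth_Cons' simp del: upt_Suc)

lemma permutation_top_first: "is_permutation (top_first j)"
  by (auto simp: top_first_def is_permutation_def simp del: upt_Suc)

lemma inversions_top_first: "inversions (top_first j) = {0} \<times> {1..j}"
proof (intro equalityI subsetI)
  fix p assume "p \<in> inversions (top_first j)"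
  then obtain a b where p: "p = (a, b)" "a < b" "b \<le> j" "top_first j ! b < top_first j ! a"
    by (auto simp: inversions_def)
  then have "a = 0" by (cases a) (auto simp: top_first_nth)
  then show "p \<in> {0} \<times> {1..j}" using p by simp
qed (auto simp: inversions_def top_first_nth)

lemma card_inversions_top_first [simp]: "card (inversions (top_first j)) = j"
  by (simp add: inversions_top_first)

lemma indecomposable_top_first: "indecomposable (top_first j)"
proof -
  have "set (take i (top_first j)) \<noteq> {1..i}" if "0 < i" "i < Suc j" for i
  proof -
    have "Suc j \<in> set (take i (top_first j))"
      using that by (auto simp: top_first_def take_Cons' simp del: upt_Suc)
    then show ?thesis using that by auto
  qed
  then show ?thesis
    using permutation_top_first by (auto simp: indecomposable_def top_first_def)
qed

text \<open>
  All inversions start at the first position, which is what rules out larger patterns.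
\<close>

lemma top_first_inversion_occurrence:
  assumes "strict_mono_on {..<length \<tau>} f" "f ` {..<length \<tau>} \<subseteq> {..<length (top_first j)}"
    "\<forall>a < length \<tau>. \<forall>b < length \<tau>. top_first j ! f a < top_first j ! f b \<longleftrightarrow> \<tau> ! a < \<tau> ! b"
    and "(a, b) \<in> inversions \<tau>"
  shows "f a = 0"
proof -
  have "a < b" "b < length \<tau>" "\<tau> ! b < \<tau> ! a" using assms(4) by (auto simp: inversions_def)
  moreover from this have "f a < f b" by (intro strict_mono_onD[OF assms(1)]) auto
  ultimately have "(f a, f b) \<in> inversions (top_first j)"
    using assms(2,3) by (auto simp: inversions_def)
  then show ?thesis by (simp add: inversions_top_first)
qed

lemma top_first_avoids_132: "\<not> contains_pattern (top_first j) (direct_sum [1] [2, 1])"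
proof
  assume "contains_pattern (top_first j) (direct_sum [1] [2, 1])"
  then obtain f where f: "strict_mono_on {..<length (direct_sum [1] [2, 1])} f"
    "f ` {..<length (direct_sum [1] [2, 1])} \<subseteq> {..<length (top_first j)}"
    "\<forall>a < length (direct_sum [1] [2, 1]). \<forall>b < length (direct_sum [1] [2, 1]).
      top_first j ! f a < top_first j ! f b \<longleftrightarrow> direct_sum [1] [2, 1] ! a < direct_sum [1] [2, 1] ! b"
    unfolding contains_pattern_def by blast
  have "(1, 2) \<in> inversions (direct_sum [1] [2, 1])"
    by (simp add: inversions_def direct_sum_def)
  then have "f 1 = 0" by (rule top_first_inversion_occurrence[OF f])
  moreover have "f 0 < f 1" by (rule strict_mono_onD[OF f(1)]) auto
  ultimately show False by simp
qed

lemma top_first_avoids_21_sum: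
  assumes "\<gamma> \<noteq> []" "is_permutation \<gamma>"
  shows "\<not> contains_pattern (top_first j) (direct_sum [2, 1] \<gamma>)"
proof
  let ?\<tau> = "direct_sum [2, 1] \<gamma>"
  assume "contains_pattern (top_first j) ?\<tau>"
  then obtain f where f: "strict_mono_on {..<length ?\<tau>} f"
    "f ` {..<length ?\<tau>} \<subseteq> {..<length (top_first j)}"
    "\<forall>a < length ?\<tau>. \<forall>b < length ?\<tau>. top_first j ! f a < top_first j ! f b \<longleftrightarrow> ?\<tau> ! a < ?\<tau> ! b"
    unfolding contains_pattern_def by blast
  have len: "2 < length ?\<tau>" using assms(1) by simp
  have "(0, 1) \<in> inversions ?\<tau>" by (simp add: inversions_def direct_sum_def)
  then have "f 0 = 0" by (rule top_first_inversion_occurrence[OF f])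
  moreover have "?\<tau> ! 0 < ?\<tau> ! 2"
    using permutation_nth(1)[OF assms(2), of 0] assms(1) by (simp add: direct_sum_def)
  ultimately have "Suc j < top_first j ! f 2"
    using f(3)[rule_format, of 0 2] len by (simp add: top_first_nth)
  moreover have "f 2 < length (top_first j)" using f(2) len by (metis image_subset_iff lessThan_iff)
  then have "top_first j ! f 2 \<le> Suc j"
    using permutation_nth(2)[OF permutation_top_first, of "f 2" j] by simp
  ultimately show False by simp
qed

lemma top_first_contains:
  assumes "0 < j"
  shows "contains_pattern (top_first j) [2, 1]" "contains_pattern (top_first j) [1]"
proof -
  show *: "contains_pattern (top_first j) [2, 1]"
    using assms by (intro contains_21) (auto simp: inversions_top_first)
  show "contains_pattern (top_first j) [1]" using contains_drop[OF *, of 1] by simp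
qed

lemma residual_top_first:
  assumes "0 < j" "fib_blocks \<alpha>s"
  shows "residual (top_first j) ([2, 1] # \<alpha>s) = \<alpha>s"
proof (rule residual_Cons_eq)
  fix \<beta> \<beta>s assume "\<alpha>s = \<beta> # \<beta>s"
  then have "\<beta> \<noteq> []" "is_permutation \<beta>" using assms(2) by (auto simp: permutation_block)
  then show "\<not> contains_pattern (top_first j) (direct_sum [2, 1] \<beta>)"
    by (rule top_first_avoids_21_sum)
qed (rule top_first_contains(1)[OF assms(1)])

lemma residual_top_first_132:
  assumes "0 < j"
  shows "residual (top_first j) [[1], [2, 1]] = [[2, 1]]"
  by (rule residual_Cons_eq) (use assms top_first_contains top_first_avoids_132 in auto)

lemma avoiders_count_ge_sum:
  assumes "fib_blocks \<alpha>s" "0 < n"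
    and "\<And>\<beta>. \<beta> \<in> A \<Longrightarrow> indecomposable \<beta> \<and> card (inversions \<beta>) \<le> k \<and> length \<beta> \<le> n"
  shows "(\<Sum>\<beta>\<in>A. avoiders_count (n - length \<beta>) (k - card (inversions \<beta>)) (fib (residual \<beta> \<alpha>s)))
    \<le> avoiders_count n k (fib \<alpha>s)"
  unfolding avoiders_count_rec[OF assms(1,2)]
  by (rule sum_mono2) (use assms(3) in \<open>auto intro: finite_subset[OF _ finite_indecomposables[of k]]\<close>)

lemma avoiders_count_prepend:
  assumes "fib_blocks \<alpha>s" "indecomposable \<beta>" "card (inversions \<beta>) \<le> k"
  shows "avoiders_count n (k - card (inversions \<beta>)) (fib (residual \<beta> \<alpha>s))
    \<le> avoiders_count (n + length \<beta>) k (fib \<alpha>s)"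
proof -
  have "0 < length \<beta>" using assms(2) by (simp add: indecomposable_def)
  then show ?thesis
    using avoiders_count_ge_sum[OF assms(1), of "n + length \<beta>" "{\<beta>}" k] assms(2,3) by simp
qed

lemma avoiders_count_Cons_1:
  assumes "fib_blocks \<alpha>s"
  shows "avoiders_count n k (fib \<alpha>s) \<le> avoiders_count (Suc n) k (fib ([1] # \<alpha>s))"
  using avoiders_count_prepend[of "[1] # \<alpha>s" "[1]" k n] assms indecomposable_1 inversions_1
  by (simp only: residual_1) simp

lemma avoiders_count_Suc:
  assumes "fib_blocks \<alpha>s"
  shows "avoiders_count n k (fib ([2, 1] # \<alpha>s)) \<le> avoiders_count (Suc n) k (fib ([2, 1] # \<alpha>s))"
  using avoiders_count_prepend[of "[2, 1] # \<alpha>s" "[1]" k n] assms indecomposable_1 inversions_1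
  by (simp only: residual_1) simp

lemma avoiders_count_Suc_top_first:
  assumes "fib_blocks \<alpha>s" "0 < j" "j \<le> k"
  shows "avoiders_count (n + j) k (fib ([2, 1] # \<alpha>s)) + avoiders_count n (k - j) (fib \<alpha>s)
    \<le> avoiders_count (Suc (n + j)) k (fib ([2, 1] # \<alpha>s))"
proof -
  have ne: "[1] \<noteq> top_first j" using assms(2) by (simp add: top_first_def)
  have "(\<Sum>\<beta>\<in>{[1], top_first j}. avoiders_count (Suc (n + j) - length \<beta>)
      (k - card (inversions \<beta>)) (fib (residual \<beta> ([2, 1] # \<alpha>s))))
    \<le> avoiders_count (Suc (n + j)) k (fib ([2, 1] # \<alpha>s))"
    by (rule avoiders_count_ge_sum)
      (use assms indecomposable_1 inversions_1 indecomposable_top_first in auto)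
  then show ?thesis
    using ne assms inversions_1 residual_1(2)[OF assms(1)] residual_top_first[OF assms(2,1)]
    by simp
qed

lemma avoiders_count_0:
  assumes "fib_blocks \<alpha>s" "\<alpha>s \<noteq> []"
  shows "avoiders_count 0 0 (fib \<alpha>s) = 1"
proof -
  have "fib \<alpha>s \<noteq> []" using assms by (cases \<alpha>s) (auto simp: direct_sum_def)
  then have "\<not> contains_pattern [] (fib \<alpha>s)" using contains_length[of "[]" "fib \<alpha>s"] by auto
  then have "avoiders 0 0 \<alpha>s = {[]}"
    by (auto simp: avoiders_def permutation_block inversions_def)
  then show ?thesis by (simp add: avoiders_count_eq)
qed

lemma avoiders_count_21_mono:
  assumes "fib_blocks \<alpha>s" "m \<le> n"
  shows "avoiders_count m k (fib ([2, 1] # \<alpha>s)) \<le> avoiders_count n k (fib ([2, 1] # \<alpha>s))"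
  using assms(2) by (rule lift_Suc_mono_le[of "\<lambda>n. avoiders_count n k (fib ([2, 1] # \<alpha>s))", rotated])
    (rule avoiders_count_Suc[OF assms(1)])

text \<open>
  By induction on the blocks. The trivial summand handles a leading 1. For a leading 21 followed by
  further blocks 21, the summand \<open>\<beta> = 21\<close> leaves \<open>k - 1\<close> inversions for the rest, and Pascal's
  rule adds up the bounds. Since 21 is avoided only by permutations without
  inversions, a remaining pattern 21 is the exception: then one summand \<open>top_first k\<close> has to
  absorb all \<open>k\<close> inversions. The hypothesis on \<open>k\<close> is one weaker than \<open>r \<le> k\<close> so that \<open>k - j\<close>
  still meets it in this case.
\<close>

lemma avoiders_count_growth:
  assumes "fib_blocks \<alpha>s" "1 \<le> count_list \<alpha>s [2, 1]" "count_list \<alpha>s [2, 1] \<le> Suc k"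
    and "\<alpha>s \<noteq> [[2, 1]] \<or> k = 0"
  shows "\<exists>m. \<forall>x. x choose (count_list \<alpha>s [2, 1] - 1) \<le> avoiders_count (x + m) k (fib \<alpha>s)"
  using assms
proof (induction \<alpha>s arbitrary: k)
  case Nil
  then show ?case by simp
next
  case (Cons \<alpha> \<alpha>s)
  have fb: "fib_blocks \<alpha>s" using Cons.prems(1) by simp
  consider (one) "\<alpha> = [1]" | (inv) "\<alpha> = [2, 1]" using Cons.prems(1) by auto
  then show ?case
  proof cases
    case one
    show ?thesis
    proof (cases "\<alpha>s = [[2, 1]] \<and> 0 < k")
      case False
      then obtain m where
        "\<forall>x. x choose (count_list \<alpha>s [2, 1] - 1) \<le> avoiders_count (x + m) k (fib \<alpha>s)"
        using Cons.IH[of k] Cons.prems one by auto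
      then have "x choose (count_list (\<alpha> # \<alpha>s) [2, 1] - 1)
          \<le> avoiders_count (x + Suc m) k (fib (\<alpha> # \<alpha>s))" for x
        using avoiders_count_Cons_1[OF fb, of "x + m" k] one
        by (auto intro: order_trans simp del: fib_simps)
      then show ?thesis by blast
    next
      case True
      \<comment> \<open>For the pattern 132, \<open>top_first k\<close> at the front takes all inversions and consumes only the 1;
        the identity follows it.\<close>
      have "1 \<le> avoiders_count (x + Suc k) k (fib (\<alpha> # \<alpha>s))" for x
      proof -
        have "1 = avoiders_count 0 0 (fib [[2, 1]])" by (subst avoiders_count_0) auto
        also have "\<dots> \<le> avoiders_count x 0 (fib [[2, 1]])"
          by (rule avoiders_count_21_mono) auto
        also have "\<dots> = avoiders_count x (k - card (inversions (top_first k)))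
            (fib (residual (top_first k) (\<alpha> # \<alpha>s)))"
          using True one residual_top_first_132[of k] by (simp del: fib_simps)
        also have "\<dots> \<le> avoiders_count (x + length (top_first k)) k (fib (\<alpha> # \<alpha>s))"
          using Cons.prems(1) indecomposable_top_first by (rule avoiders_count_prepend) simp
        finally show ?thesis by simp
      qed
      then show ?thesis using True one by (intro exI[of _ "Suc k"]) (simp del: fib_simps)
    qed
  next
    case inv
    show ?thesis
    proof (cases "count_list \<alpha>s [2, 1] = 0")
      case True
      \<comment> \<open>A single avoider suffices, as the counts increase for a pattern that starts with 21.\<close>
      have "\<exists>m. 1 \<le> avoiders_count m k (fib (\<alpha> # \<alpha>s))"
      proof (cases "k = 0")
        case True
        then show ?thesis
          using avoiders_count_0[OF Cons.prems(1)] by (intro exI[of _ 0]) (simp del: fib_simps)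
      next
        case False
        then have "\<alpha>s \<noteq> []" using Cons.prems(4) inv by auto
        then have "1 = avoiders_count 0 (k - card (inversions (top_first k)))
            (fib (residual (top_first k) (\<alpha> # \<alpha>s)))"
          using False inv residual_top_first[of k \<alpha>s] fb avoiders_count_0[OF fb]
          by (simp del: fib_simps)
        also have "\<dots> \<le> avoiders_count (0 + length (top_first k)) k (fib (\<alpha> # \<alpha>s))"
          using Cons.prems(1) indecomposable_top_first by (rule avoiders_count_prepend) simp
        finally show ?thesis by blast
      qed
      then obtain m where m: "1 \<le> avoiders_count m k (fib (\<alpha> # \<alpha>s))" by blast
      have "1 \<le> avoiders_count (x + m) k (fib (\<alpha> # \<alpha>s))" for x
        using m avoiders_count_21_mono[OF fb, of m "x + m" k] inv by (simp del: fib_simps)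
      then show ?thesis using True inv by (intro exI[of _ m]) (simp del: fib_simps)
    next
      case False
      then obtain e where e: "count_list \<alpha>s [2, 1] = Suc e" using not0_implies_Suc by blast
      \<comment> \<open>A remaining pattern 21 can only be avoided if no inversion is left over.\<close>
      define j where "j = (if \<alpha>s = [[2, 1]] then k else 1)"
      have j: "0 < j" "j \<le> k" using Cons.prems(3) inv e by (auto simp: j_def)
      have "\<exists>m. \<forall>x. x choose e \<le> avoiders_count (x + m) (k - j) (fib \<alpha>s)"
        using Cons.IH[of "k - j"] fb e Cons.prems(3) inv by (auto simp: j_def split: if_splits)
      then obtain m where m: "\<And>x. x choose e \<le> avoiders_count (x + m) (k - j) (fib \<alpha>s)" by blast
      have "x choose Suc e \<le> avoiders_count (x + (m + j)) k (fib (\<alpha> # \<alpha>s))" for x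
      proof (induction x)
        case (Suc x)
        have "Suc x choose Suc e = (x choose Suc e) + (x choose e)" by simp
        also have "\<dots> \<le> avoiders_count (x + m + j) k (fib (\<alpha> # \<alpha>s)) +
            avoiders_count (x + m) (k - j) (fib \<alpha>s)"
          using Suc m[of x] by (intro add_mono) (simp_all add: add.assoc)
        also have "\<dots> \<le> avoiders_count (Suc (x + m + j)) k (fib (\<alpha> # \<alpha>s))"
          unfolding inv using fb j by (rule avoiders_count_Suc_top_first)
        finally show ?case by (simp add: add.assoc)
      qed simp
      then show ?thesis using inv e by (intro exI[of _ "m + j"]) (simp del: fib_simps)
    qed
  qed
qed

section \<open>Degree of the counting polynomial\<close>

theorem proposition21:
  fixes \<tau> :: "nat list" and r k :: nat
  assumes "fibonacci_permutation \<tau>"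
    and "card (inversions \<tau>) = r"
    and "r \<ge> 1"
    and "k \<ge> r"
  shows "\<exists>P :: real poly.
           degree P = r - 1 \<and> (P \<noteq> 0 \<or> \<tau> = [2, 1]) \<and>
           (\<exists>n0 :: nat. \<forall>n \<ge> n0. real (avoiders_count n k \<tau>) = poly P (real n))"
proof -
  obtain \<alpha>s where fb: "fib_blocks \<alpha>s" and \<tau>: "\<tau> = fib \<alpha>s"
    using assms(1) by (auto simp: fibonacci_permutation_def fib_blocks_def fib_def)
  have r: "count_list \<alpha>s [2, 1] = r"
    using card_inversions_fib[OF fb] assms(2) \<tau> by simp
  obtain P :: "real poly" and N where P: "\<forall>i\<ge>r. coeff P i = 0"
    and N: "\<And>n. n \<ge> N \<Longrightarrow> real (avoiders_count n k \<tau>) = poly P (real n)"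
    using avoiders_count_eventually_poly[OF fb, of k]
    unfolding eventually_poly_def eventually_sequentially r \<tau> by blast
  have le: "degree P \<le> r - 1"
    using P assms(3) by (intro degree_le) auto
  have "degree P = r - 1 \<and> (P \<noteq> 0 \<or> \<tau> = [2, 1])"
  proof (cases "\<tau> = [2, 1]")
    case True
    then have "inversions \<tau> = {(0, 1)}" by (auto simp: inversions_def less_Suc_eq)
    then have "r = 1" using assms(2) by simp
    then show ?thesis using le True by simp
  next
    case False
    then have "\<alpha>s \<noteq> [[2, 1]]" using \<tau> by auto
    then obtain m where m: "\<And>x. x choose (r - 1) \<le> avoiders_count (x + m) k \<tau>"
      using avoiders_count_growth[OF fb, of k] assms(3,4) r \<tau> by auto
    have "coeff P (r - 1) \<noteq> 0"
    proof (rule binomial_growth_coeff_nonzero)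
      show "\<forall>i\<ge>Suc (r - 1). coeff P i = 0" using P by auto
      show "real (x choose (r - 1)) \<le> poly P (real (x + m))" if "x \<ge> N" for x
        using m[of x] N[of "x + m"] that by (metis of_nat_le_iff trans_le_add1)
    qed
    then show ?thesis using le le_degree[of P "r - 1"] by auto
  qed
  then show ?thesis using N by blast
qed

end
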